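(* Let $n\ge 1$ be an integer not divisible by $3$. Then \[ C_{3,n}(q,t)=\sum_{s=0}^{\lfloor n/3 \rfloor}\ \sum_{\substack{a,d\geq s\\ a+s+d+1=n}}q^d t^a=\sum_{s=0}^{\lfloor n/3 \rfloor}\ \sum_{a=s}^{n-2s-1}q^{n-a-s-1}t^a, \] where the inner sums range over non-negative integers $a,d$.
   Context: A $(3,n)$-Dyck path is a lattice path from $(0,0)$ to $(3,n)$ using unit north and east steps that stays weakly above the line $y=\frac{n}{3}x$. The rectangle $[0,3]\times[0,n]$ is divided into unit cells; the cell $(a,b)$ (column $a\in\{1,2,3\}$ from left, row $b\in\{1,\dots,n\}$ from bottom) is $[a-1,a]\times[b-1,b]$. For a $(3,n)$-Dyck path $\Pi$, let $\lambda(\Pi)$ be the set of cells of the rectangle lying above (north-west of) the path $\Pi$. $\operatorname{area}(\Pi)$ is the number of cells lying entirely between the path $\Pi$ and the line $y=\frac{n}{3}x$ (below the path and above the diagonal). For $x\in\lambda(\Pi)$, $\operatorname{arm}(x)$ (resp. $\operatorname{leg}(x)$) is the number of cells of $\lambda(\Pi)$ strictly east of $x$ in the same row (resp. strictly south of $x$ in the same column). $\operatorname{dinv}(\Pi)$ is the number of cells $x\in\lambda(\Pi)$ with $\frac{\operatorname{arm}(x)}{\operatorname{leg}(x)+1}<\frac{3}{n}<\frac{\operatorname{arm}(x)+1}{\operatorname{leg}(x)}$ (the right-hand fraction is $+\infty$ when $\operatorname{leg}(x)=0$). The rational $q,t$-Catalan polynomial is $C_{3,n}(q,t)=\sum_{\Pi}q^{\operatorname{dinv}(\Pi)}t^{\operatorname{area}(\Pi)}$,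 summed over all $(3,n)$-Dyck paths $\Pi$. *)

theory Defs
  imports Complex_Main "HOL-Computational_Algebra.Polynomial"
begin

datatype step = North | East

definition endpoint :: "step list \<Rightarrow> nat \<times> nat" where
  "endpoint p = (count_list p East, count_list p North)"

text \<open>It suffices to test the line condition at the lattice points of the path, since
  every step is a straight segment.\<close>

definition dyck_paths :: "nat \<Rightarrow> step list set" where
  "dyck_paths n = {p. endpoint p = (3, n) \<and>
     (\<forall>k \<le> length p. \<forall>x y. endpoint (take k p) = (x, y) \<longrightarrow> real n / 3 * real x \<le> real y)}"

text \<open>The pair \<open>(a, b)\<close> stands for the closed unit square with upper right corner \<open>(a, b)\<close>.\<close>

definition cells :: "nat \<Rightarrow> (nat \<times> nat) set" where
  "cells n = {1..3} \<times> {1..n}"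

text \<open>\<open>east_step p a h\<close>: the path crosses column \<open>a\<close> by a step from \<open>(a - 1, h)\<close> to \<open>(a, h)\<close>.
  A cell of that column lies above or below the path according to its position relative
  to this step.\<close>

definition east_step :: "step list \<Rightarrow> nat \<Rightarrow> nat \<Rightarrow> bool" where
  "east_step p a h \<longleftrightarrow>
     (\<exists>k < length p. p ! k = East \<and> endpoint (take k p) = (a - 1, h) \<and> endpoint (take (Suc k) p) = (a, h))"

definition cells_above :: "nat \<Rightarrow> step list \<Rightarrow> (nat \<times> nat) set" where
  "cells_above n p = {(a, b) \<in> cells n. \<exists>h. east_step p a h \<and> h \<le> b - 1}"

definition cells_below :: "nat \<Rightarrow> step list \<Rightarrow> (nat \<times> nat) set" where
  "cells_below n p = {(a, b) \<in> cells n. \<exists>h. east_step p a h \<and> b \<le> h}"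

definition above_diagonal :: "nat \<Rightarrow> nat \<times> nat \<Rightarrow> bool" where
  "above_diagonal n = (\<lambda>(a, b). \<forall>x \<in> {real a - 1..real a}. \<forall>y \<in> {real b - 1..real b}. real n / 3 * x \<le> y)"

definition area :: "nat \<Rightarrow> step list \<Rightarrow> nat" where
  "area n p = card {c \<in> cells_below n p. above_diagonal n c}"

definition arm :: "nat \<Rightarrow> step list \<Rightarrow> nat \<times> nat \<Rightarrow> nat" where
  "arm n p = (\<lambda>(a, b). card {(a', b') \<in> cells_above n p. b' = b \<and> a < a'})"

definition leg :: "nat \<Rightarrow> step list \<Rightarrow> nat \<times> nat \<Rightarrow> nat" where
  "leg n p = (\<lambda>(a, b). card {(a', b') \<in> cells_above n p. a' = a \<and> b' < b})"

definition dinv :: "nat \<Rightarrow> step list \<Rightarrow> nat" where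
  "dinv n p = card {c \<in> cells_above n p.
     real (arm n p c) / (real (leg n p c) + 1) < 3 / real n \<and>
     (leg n p c = 0 \<or> 3 / real n < (real (arm n p c) + 1) / real (leg n p c))}"

text \<open>Polynomials in \<open>q\<close> and \<open>t\<close> are represented as polynomials in \<open>t\<close> with coefficients
  in \<open>\<int>[q]\<close>.\<close>

definition qvar :: "int poly poly" where
  "qvar = [:[:0, 1:]:]"

definition tvar :: "int poly poly" where
  "tvar = [:0, 1:]"

definition qt_catalan3 :: "nat \<Rightarrow> int poly poly" where
  "qt_catalan3 n = (\<Sum>p \<in> dyck_paths n. qvar ^ dinv n p * tvar ^ area n p)"

end

theory Submission
  imports Defs
begin

text \<open>A \<open>(3, n)\<close>-Dyck path is determined by the heights \<open>i \<le> j\<close> of its first two east steps.  With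
  \<open>x = n - i\<close>, \<open>y = n - j\<close> and \<open>k = \<lfloor>n / 3\<rfloor>\<close>, the area is \<open>n - 1 - x - y\<close>, and of the \<open>x + y\<close> cells
  above the path all but \<open>s\<close> count for dinv, where \<open>s = x - y - k - 1\<close> if \<open>x - y > k\<close>, \<open>s = y\<close> if
  \<open>x \<le> k\<close>, and \<open>s = k + y - x\<close> otherwise.  For a fixed sum \<open>m = x + y\<close> the first and the last case
  produce, in alternating parity, the values \<open>s < m - k\<close>, while the middle case produces the values
  \<open>s \<ge> m - k\<close>; hence \<open>(x, y) \<mapsto> (s, m)\<close> is a bijection.\<close>

subsection \<open>Paths with three east steps\<close>

definition three_path :: "nat \<Rightarrow> nat \<Rightarrow> nat \<Rightarrow> step list" where
  "three_path n i j =
     replicate i North @ East # replicate (j - i) North @ East # replicate (n - j) North @ [East]"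

section \<open>Cutting step words at their east steps\<close>

lemma count_list_replicate_North:
  "count_list (replicate a North) East = 0" "count_list (replicate a North) North = a"
  by (induction a) auto

text \<open>A cut falls either within the leading block of north steps, possibly right before its
  \<open>East\<close>, or after that \<open>East\<close>. Iterating this alternative lists all
  prefixes of a word with three east steps.\<close>

lemma append_eq_North_block:
  "u @ v = replicate a North @ East # q \<longleftrightarrow>
     (\<exists>i\<le>a. u = replicate i North \<and> v = replicate (a - i) North @ East # q) \<or>
     (\<exists>u'. u = replicate a North @ East # u' \<and> u' @ v = q)"
proof (induction a arbitrary: u)
  case 0
  then show ?case by (cases u) auto
next
  case (Suc a)
  show ?case
  proof (cases u)
    case Nil
    then show ?thesis by force
  next
    case (Cons c w)
    have "(\<exists>i\<le>Suc a. u = replicate i North \<and> v = replicate (Suc a - i) North @ East # q) \<longleftrightarrow>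
      c = North \<and> (\<exists>i\<le>a. w = replicate i North \<and> v = replicate (a - i) North @ East # q)"
      (is "?L = ?R")
    proof
      assume ?L
      then obtain i where "i \<le> Suc a" "u = replicate i North"
        "v = replicate (Suc a - i) North @ East # q" by blast
      then show ?R using Cons by (cases i) auto
    next
      assume ?R
      then obtain i where "c = North" "i \<le> a" "w = replicate i North"
        "v = replicate (a - i) North @ East # q" by blast
      then show ?L using Cons by (intro exI[of _ "Suc i"]) auto
    qed
    then show ?thesis using Suc.IH[of w] Cons by auto
  qed
qed

lemma append_East_eq_North_block:
  "replicate a North @ East # q = u @ East # v \<longleftrightarrow>
     (u = replicate a North \<and> v = q) \<or> (\<exists>u'. u = replicate a North @ East # u' \<and> q = u' @ East # v)"
proof -
  \<comment> \<open>A cut within the block leaves \<open>d\<close> north steps in front, so the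
    remainder starts with \<open>East\<close> only for \<open>d = 0\<close>.\<close>
  have "East # v = replicate d North @ East # q \<longleftrightarrow> d = 0 \<and> v = q" for d
    by (cases d) auto
  then show ?thesis
    using append_eq_North_block[of u "East # v" a q] by (auto simp: eq_commute)
qed

lemma ex_North_block:
  assumes "count_list p East = Suc m"
  shows "\<exists>a q. p = replicate a North @ East # q \<and> count_list q East = m"
  using assms
proof (induction p)
  case (Cons c p)
  show ?case
  proof (cases c)
    case North
    then obtain a q where "p = replicate a North @ East # q" "count_list q East = m"
      using Cons by auto
    then show ?thesis using North by (intro exI[of _ "Suc a"]) auto
  next
    case East
    then show ?thesis using Cons.prems by (intro exI[of _ 0]) auto
  qed
qed simp

lemma count_list_East_eq_0:
  assumes "count_list p East = 0"
  shows "\<exists>a. p = replicate a North"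
proof -
  have "\<forall>c\<in>set p. c = North"
    using assms by (metis (full_types) count_list_0_iff step.exhaust)
  then show ?thesis by (metis replicate_length_same)
qed

text \<open>An east step raises the abscissa by one, so the condition on its second endpoint reduces
  to \<open>a \<ge> 1\<close>; this excludes \<open>a = 0\<close>, where \<open>a - 1\<close> is
  truncated to 0.\<close>

lemma east_step_iff:
  "east_step p a h \<longleftrightarrow> (\<exists>u v. p = u @ East # v \<and> endpoint u = (a - 1, h) \<and> a \<ge> 1)"
proof
  assume "east_step p a h"
  then obtain k where k: "k < length p" "p ! k = East" "endpoint (take k p) = (a - 1, h)"
      "endpoint (take (Suc k) p) = (a, h)"
    unfolding east_step_def by blast
  then have "a \<ge> 1" by (auto simp: take_Suc_conv_app_nth endpoint_def)
  moreover have "p = take k p @ East # drop (Suc k) p"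
    using k(1,2) by (metis id_take_nth_drop)
  ultimately show "\<exists>u v. p = u @ East # v \<and> endpoint u = (a - 1, h) \<and> a \<ge> 1"
    using k(3) by blast
next
  assume "\<exists>u v. p = u @ East # v \<and> endpoint u = (a - 1, h) \<and> a \<ge> 1"
  then obtain u v where "p = u @ East # v" "endpoint u = (a - 1, h)" "a \<ge> 1" by blast
  then show "east_step p a h"
    unfolding east_step_def by (intro exI[of _ "length u"]) (auto simp: endpoint_def)
qed

lemma east_step_three_path:
  assumes "i \<le> j" "j \<le> n"
  shows "east_step (three_path n i j) a h \<longleftrightarrow> a = 1 \<and> h = i \<or> a = 2 \<and> h = j \<or> a = 3 \<and> h = n"
    (is "?L \<longleftrightarrow> ?R")
proof
  assume ?L
  then show ?R
    unfolding east_step_iff three_path_def append_East_eq_North_block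
    using assms by (auto simp: endpoint_def count_list_replicate_North)
next
  let ?u1 = "replicate i North" and ?v1 = "replicate (j - i) North" and ?w1 = "replicate (n - j) North"
  have p: "three_path n i j = ?u1 @ East # ?v1 @ East # ?w1 @ [East]"
      "three_path n i j = (?u1 @ East # ?v1) @ East # ?w1 @ [East]"
      "three_path n i j = (?u1 @ East # ?v1 @ East # ?w1) @ East # []"
    by (simp_all add: three_path_def)
  assume ?R
  then consider "a = 1" "h = i" | "a = 2" "h = j" | "a = 3" "h = n" by blast
  then show ?L
  proof cases
    case 1
    show ?thesis unfolding east_step_iff 1
      by (intro exI conjI, rule p(1)) (auto simp: endpoint_def count_list_replicate_North)
  next
    case 2
    show ?thesis unfolding east_step_iff 2
      by (intro exI conjI, rule p(2)) (use assms in \<open>auto simp: endpoint_def count_list_replicate_North\<close>)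
  next
    case 3
    show ?thesis unfolding east_step_iff 3
      by (intro exI conjI, rule p(3)) (use assms in \<open>auto simp: endpoint_def count_list_replicate_North\<close>)
  qed
qed

text \<open>The heights are read off from the east steps in columns 1 and 2. \<open>P\<close> leaves
  room for the height bounds of Dyck paths.\<close>

lemma inj_on_three_path: "inj_on (\<lambda>(i, j). three_path n i j) {(i, j). i \<le> j \<and> j \<le> n \<and> P i j}"
proof (rule inj_onI, clarify)
  fix i j i' j'
  assume "i \<le> j" "j \<le> n" "i' \<le> j'" "j' \<le> n" "three_path n i j = three_path n i' j'"
  then show "i = i' \<and> j = j'"
    using east_step_three_path[of i j n 1 i] east_step_three_path[of i' j' n 1 i]
      east_step_three_path[of i j n 2 j] east_step_three_path[of i' j' n 2 j] by auto
qed

section \<open>Dyck paths as pairs of heights\<close>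

lemma dyck_paths_iff_prefixes:
  "p \<in> dyck_paths n \<longleftrightarrow> endpoint p = (3, n) \<and>
     (\<forall>u v. p = u @ v \<longrightarrow> n * count_list u East \<le> 3 * count_list u North)"
proof -
  have le: "real n / 3 * real x \<le> real y \<longleftrightarrow> n * x \<le> 3 * y" for x y
  proof -
    have "real n / 3 * real x \<le> real y \<longleftrightarrow> real (n * x) \<le> real (3 * y)"
      by (simp add: field_simps)
    then show ?thesis by (simp only: of_nat_le_iff)
  qed
  have "(\<forall>k\<le>length p. n * count_list (take k p) East \<le> 3 * count_list (take k p) North) \<longleftrightarrow>
    (\<forall>u v. p = u @ v \<longrightarrow> n * count_list u East \<le> 3 * count_list u North)"
    by (metis append_eq_conv_conj append_take_drop_id le_add1 length_append)
  then show ?thesis unfolding dyck_paths_def mem_Collect_eq le by (simp add: endpoint_def)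
qed

text \<open>North steps preserve the line condition, so only the points right after east steps
  matter. The first two give the bounds on \<open>i\<close> and \<open>j\<close>; the third must
  have height \<open>n\<close>, so no north step follows it.\<close>

lemma dyck_paths_eq:
  "dyck_paths n = (\<lambda>(i, j). three_path n i j) ` {(i, j). i \<le> j \<and> j \<le> n \<and> n \<le> 3 * i \<and> 2 * n \<le> 3 * j}"
proof (intro equalityI subsetI)
  fix p assume p: "p \<in> dyck_paths n"
  then have cnt: "count_list p East = Suc 2" "count_list p North = n"
    by (auto simp: dyck_paths_iff_prefixes endpoint_def)
  have pre: "n * count_list u East \<le> 3 * count_list u North" if "p = u @ v" for u v
    using p that unfolding dyck_paths_iff_prefixes by blast
  obtain a q where q: "p = replicate a North @ East # q" "count_list q East = Suc 1"
    using ex_North_block[of p 2] cnt by (auto simp: numeral_2_eq_2)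
  obtain b r where r: "q = replicate b North @ East # r" "count_list r East = Suc 0"
    using ex_North_block[OF q(2)] by auto
  obtain c w where w: "r = replicate c North @ East # w" "count_list w East = 0"
    using ex_North_block[OF r(2)] by auto
  obtain d where d: "w = replicate d North" using count_list_East_eq_0[OF w(2)] by blast
  note p_eq = q(1) r(1) w(1) d
  have n: "n = a + b + c + d"
    using cnt(2) p_eq by (simp add: count_list_replicate_North)
  have "n \<le> 3 * a"
    using pre[of "replicate a North @ [East]" q] p_eq by (simp add: count_list_replicate_North)
  moreover have "2 * n \<le> 3 * (a + b)"
    using pre[of "replicate a North @ East # replicate b North @ [East]" r] p_eq
    by (simp add: count_list_replicate_North)
  moreover have "3 * n \<le> 3 * (a + b + c)"
    using pre[of "replicate a North @ East # replicate b North @ East # replicate c North @ [East]" w]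
      p_eq by (simp add: count_list_replicate_North)
  moreover from this n have "d = 0" by simp
  ultimately show "p \<in> (\<lambda>(i, j). three_path n i j) `
      {(i, j). i \<le> j \<and> j \<le> n \<and> n \<le> 3 * i \<and> 2 * n \<le> 3 * j}"
    using p_eq n by (intro image_eqI[of _ _ "(a, a + b)"]) (auto simp: three_path_def)
next
  fix p assume "p \<in> (\<lambda>(i, j). three_path n i j) `
      {(i, j). i \<le> j \<and> j \<le> n \<and> n \<le> 3 * i \<and> 2 * n \<le> 3 * j}"
  then obtain i j where p: "p = three_path n i j" and ij: "i \<le> j" "j \<le> n" "n \<le> 3 * i" "2 * n \<le> 3 * j"
    by auto
  have "n * count_list u East \<le> 3 * count_list u North" if "p = u @ v" for u v
  proof -
    \<comment> \<open>Writing the end as \<open>East # []\<close> lets the splitting rule apply to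
      the third block as well.\<close>
    have "u @ v = replicate i North @ East # replicate (j - i) North @ East # replicate (n - j) North @ East # []"
      using that p by (simp add: three_path_def)
    then show ?thesis
      unfolding append_eq_North_block using ij by (auto simp: count_list_replicate_North)
  qed
  then show "p \<in> dyck_paths n"
    unfolding dyck_paths_iff_prefixes
    using p ij by (auto simp: endpoint_def three_path_def count_list_replicate_North)
qed

subsection \<open>The two statistics\<close>

lemma card_two_columns:
  fixes A B :: "nat set"
  assumes "finite A" "finite B"
  shows "card (Pair (1::nat) ` A \<union> Pair 2 ` B) = card A + card B"
  using assms by (subst card_Un_disjoint) (auto simp: card_image inj_on_def)

text \<open>The line is highest at the right edge of the cell and the cell is lowest at its bottom
  edge, so the lower right corner \<open>(a, b - 1)\<close> decides.\<close>

lemma above_diagonal_iff: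
  assumes "b \<ge> 1"
  shows "above_diagonal n (a, b) \<longleftrightarrow> n * a \<le> 3 * (b - 1)"
proof -
  have "above_diagonal n (a, b) \<longleftrightarrow> real n / 3 * real a \<le> real b - 1"
  proof
    assume "above_diagonal n (a, b)"
    then have "\<forall>x\<in>{real a - 1..real a}. \<forall>y\<in>{real b - 1..real b}. real n / 3 * x \<le> y"
      unfolding above_diagonal_def by (simp only: prod.case)
    then show "real n / 3 * real a \<le> real b - 1"
      by (elim ballE[of _ _ "real a"] ballE[of _ _ "real b - 1"]) auto
  next
    assume *: "real n / 3 * real a \<le> real b - 1"
    have "real n / 3 * x \<le> real n / 3 * real a" if "x \<le> real a" for x
      using that by (intro mult_left_mono) auto
    with * show "above_diagonal n (a, b)" unfolding above_diagonal_def by fastforce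
  qed
  also have "\<dots> \<longleftrightarrow> real (n * a) \<le> real (3 * (b - 1))"
    using assms by (simp add: field_simps of_nat_diff)
  finally show ?thesis by (simp only: of_nat_le_iff)
qed

lemma area_three_path:
  assumes "i \<le> j" "j \<le> n" "n = 3 * k + r" "r = 1 \<or> r = 2" "n \<le> 3 * i" "2 * n \<le> 3 * j"
  shows "area n (three_path n i j) = i + j - (n + 1)"
proof -
  have "{c \<in> cells_below n (three_path n i j). above_diagonal n c} =
     Pair 1 ` {k + 2..i} \<union> Pair 2 ` {n - k + 1..j}"
  proof (intro set_eqI)
    fix c :: "nat \<times> nat"
    obtain a b where c: "c = (a, b)" by fastforce
    have "c \<in> cells_below n (three_path n i j) \<and> above_diagonal n c \<longleftrightarrow>
       1 \<le> b \<and> b \<le> n \<and> n * a \<le> 3 * (b - 1) \<and> (a = 1 \<and> b \<le> i \<or> a = 2 \<and> b \<le> j \<or> a = 3)"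
      using above_diagonal_iff[of b n a] assms
      by (auto simp: c cells_below_def cells_def east_step_three_path)
    \<comment> \<open>For both residues \<open>r\<close>, \<open>n / 3\<close> rounds up to
      \<open>k + 1\<close> and \<open>2 * n / 3\<close> to \<open>2 * k + r = n - k\<close>. Column
      3 would need \<open>b > n\<close>.\<close>
    also have "\<dots> \<longleftrightarrow> a = 1 \<and> k + 2 \<le> b \<and> b \<le> i \<or> a = 2 \<and> n - k + 1 \<le> b \<and> b \<le> j"
      using assms by auto
    finally show "c \<in> {c \<in> cells_below n (three_path n i j). above_diagonal n c} \<longleftrightarrow>
        c \<in> Pair 1 ` {k + 2..i} \<union> Pair 2 ` {n - k + 1..j}"
      by (auto simp: c)
  qed
  then have "area n (three_path n i j) = card {k + 2..i} + card {n - k + 1..j}"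
    unfolding area_def by (simp only: card_two_columns finite_atLeastAtMost)
  then show ?thesis using assms by auto
qed

text \<open>Column 3 is empty because its east step has height \<open>n\<close>.\<close>

lemma cells_above_three_path:
  assumes "i \<le> j" "j \<le> n"
  shows "cells_above n (three_path n i j) = Pair 1 ` {i + 1..n} \<union> Pair 2 ` {j + 1..n}"
  using assms by (auto simp: cells_above_def cells_def east_step_three_path)

section \<open>Arms, legs and dinv\<close>

lemma arm_three_path:
  assumes "i \<le> j" "j \<le> n" "b \<le> n"
  shows "arm n (three_path n i j) (1, b) = (if j < b then 1 else 0)"
    and "arm n (three_path n i j) (2, b) = 0"
proof -
  have eq: "{(a', b') \<in> cells_above n (three_path n i j). b' = b \<and> 1 < a'} = (if j < b then {(2, b)} else {})"
    using assms by (auto simp: cells_above_three_path)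
  show "arm n (three_path n i j) (1, b) = (if j < b then 1 else 0)"
    unfolding arm_def prod.case eq by simp
  have eq: "{(a', b') \<in> cells_above n (three_path n i j). b' = b \<and> 2 < a'} = {}"
    using assms by (auto simp: cells_above_three_path)
  show "arm n (three_path n i j) (2, b) = 0"
    unfolding arm_def prod.case eq by simp
qed

lemma leg_three_path:
  assumes "i \<le> j" "j \<le> n" "b \<le> n"
  shows "leg n (three_path n i j) (1, b) = b - 1 - i"
    and "leg n (three_path n i j) (2, b) = b - 1 - j"
proof -
  have eq: "{(a', b') \<in> cells_above n (three_path n i j). a' = 1 \<and> b' < b} = Pair 1 ` {i + 1..<b}"
    using assms by (auto simp: cells_above_three_path)
  show "leg n (three_path n i j) (1, b) = b - 1 - i"
    unfolding leg_def prod.case eq by (simp add: card_image inj_on_def)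
  have eq: "{(a', b') \<in> cells_above n (three_path n i j). a' = 2 \<and> b' < b} = Pair 2 ` {j + 1..<b}"
    using assms by (auto simp: cells_above_three_path)
  show "leg n (three_path n i j) (2, b) = b - 1 - j"
    unfolding leg_def prod.case eq by (simp add: card_image inj_on_def)
qed

text \<open>Clearing denominators; for \<open>L = 0\<close> the second inequality becomes
  \<open>0 < n * (A + 1)\<close>, so the exceptional case needs no separate treatment.\<close>

lemma slope_cond_iff:
  fixes A L n :: nat
  assumes "n \<ge> 1"
  shows "real A / (real L + 1) < 3 / real n \<and> (L = 0 \<or> 3 / real n < (real A + 1) / real L) \<longleftrightarrow>
    n * A < 3 * (L + 1) \<and> 3 * L < n * (A + 1)"
proof -
  have "real A / (real L + 1) < 3 / real n \<longleftrightarrow> real (n * A) < real (3 * (L + 1))"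
    using assms by (simp add: field_simps)
  moreover have "0 < real n + real A * real n"
    using assms by (intro add_pos_nonneg) auto
  then have "L = 0 \<or> 3 / real n < (real A + 1) / real L \<longleftrightarrow> real (3 * L) < real (n * (A + 1))"
    using assms by (cases "L = 0") (simp_all add: field_simps)
  ultimately show ?thesis by (simp only: of_nat_less_iff)
qed

lemma dinv_three_path:
  assumes "i \<le> j" "j \<le> n" "n = 3 * k + r" "r = 1 \<or> r = 2" "n \<le> 3 * i" "2 * n \<le> 3 * j"
  shows "dinv n (three_path n i j) =
    (n - j) + min (j - i) (k + 1) + (n - max j (i + k))"
proof -
  have n1: "n \<ge> 1" using assms by auto
  have "{c \<in> cells_above n (three_path n i j).
      real (arm n (three_path n i j) c) / (real (leg n (three_path n i j) c) + 1) < 3 / real n \<and>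
      (leg n (three_path n i j) c = 0 \<or>
       3 / real n < (real (arm n (three_path n i j) c) + 1) / real (leg n (three_path n i j) c))} =
    Pair 1 ` ({i + 1..min j (i + k + 1)} \<union> {max (j + 1) (i + k + 1)..n}) \<union> Pair 2 ` {j + 1..n}"
    (is "?D = ?R")
  proof (intro set_eqI)
    fix c :: "nat \<times> nat"
    obtain a b where c: "c = (a, b)" by fastforce
    consider "a = 1" "i < b" "b \<le> n" | "a = 2" "j < b" "b \<le> n"
      | "c \<notin> cells_above n (three_path n i j)" 
      using assms by (fastforce simp: c cells_above_three_path)
    then show "c \<in> ?D \<longleftrightarrow> c \<in> ?R"
    proof cases
      case 1
      have "c \<in> cells_above n (three_path n i j)"
        using 1 assms by (auto simp: c cells_above_three_path)
      then have "c \<in> ?D \<longleftrightarrow> n * (if j < b then 1 else 0) < 3 * (b - 1 - i + 1) \<and>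
          3 * (b - 1 - i) < n * ((if j < b then 1 else 0) + 1)"
        unfolding mem_Collect_eq slope_cond_iff[OF n1]
        using 1(2) by (simp add: c 1(1) arm_three_path[OF assms(1,2) 1(3)]
          leg_three_path[OF assms(1,2) 1(3)] del: One_nat_def)
      \<comment> \<open>With arm 0 the condition says that the leg is at most \<open>k\<close>. With
        arm 1 it says that the leg is at least \<open>k\<close>; the other bound,
        \<open>3 * leg < 2 * n\<close>, follows from \<open>n \<le> 3 * i\<close>.\<close>
      also have "\<dots> \<longleftrightarrow> b \<le> j \<and> b \<le> i + k + 1 \<or> j < b \<and> i + k + 1 \<le> b"
        using 1 assms by (cases "j < b") auto
      also have "\<dots> \<longleftrightarrow> c \<in> ?R" using 1 by (auto simp: c)
      finally show ?thesis .
    next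
      case 2
      have "c \<in> cells_above n (three_path n i j)"
        using 2 assms by (auto simp: c cells_above_three_path)
      then have "c \<in> ?D \<longleftrightarrow> 3 * (b - 1 - j) < n"
        unfolding mem_Collect_eq slope_cond_iff[OF n1]
        using 2(2) by (simp add: c 2(1) arm_three_path[OF assms(1,2) 2(3)]
          leg_three_path[OF assms(1,2) 2(3)] del: One_nat_def)
      \<comment> \<open>The leg is less than \<open>n - j\<close>, and
        \<open>3 * (n - j) \<le> n\<close>: every cell of column 2 counts.\<close>
      also have "\<dots> \<longleftrightarrow> True" using 2 assms by auto
      also have "\<dots> \<longleftrightarrow> c \<in> ?R" using 2 by (auto simp: c)
      finally show ?thesis .
    next
      case 3
      then show ?thesis using assms by (auto simp: cells_above_three_path)
    qed
  qed
  moreover have "card ({i + 1..min j (i + k + 1)} \<union> {max (j + 1) (i + k + 1)..n}) =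
      min (j - i) (k + 1) + (n - max j (i + k))"
    by (subst card_Un_disjoint) (auto simp: min_def max_def)
  ultimately show ?thesis
    unfolding dinv_def by (simp add: card_two_columns del: One_nat_def)
qed

subsection \<open>The bijection\<close>

text \<open>The number of cells above the path that dinv misses, all in column 1. If
  \<open>x - y > k\<close>, these are the arm 0 cells with leg above \<open>k\<close>; otherwise
  they are the arm 1 cells with leg below \<open>k\<close>, which are all \<open>y\<close> arm 1
  cells when \<open>x \<le> k\<close>.\<close>

definition defect :: "nat \<Rightarrow> nat \<Rightarrow> nat \<Rightarrow> nat" where
  "defect k x y = (if k < x - y then x - y - k - 1 else if x \<le> k then y else k + y - x)"

text \<open>Solves for \<open>y\<close> given \<open>s\<close> and \<open>m = x + y\<close>: the
  three branches come from \<open>s = y\<close>, \<open>x - y = k - s\<close> and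
  \<open>x - y = k + s + 1\<close>. The last two differ in the parity of
  \<open>s + m - k\<close>.\<close>

definition defect_inv :: "nat \<Rightarrow> nat \<Rightarrow> nat \<Rightarrow> nat" where
  "defect_inv k s m =
     (if m \<le> k + s then s else if even (s + m - k) then (s + m - k) div 2 else (m - k - 1 - s) div 2)"

lemma defect_inv_defect:
  assumes "y \<le> x"
  shows "defect_inv k (defect k x y) (x + y) = y"
proof -
  consider "k < x - y" | "x \<le> k" | "k < x" "x - y \<le> k" by linarith
  then show ?thesis
  proof cases
    case 1
    then obtain c where "x = y + k + 1 + c"
      by (metis Suc_eq_plus1 add.assoc less_imp_Suc_add less_diff_conv add.commute)
    then have "defect k x y = c" "x + y = k + c + 2 * y + 1" by (simp_all add: defect_def)
    \<comment> \<open>The sum is odd, which selects the last branch of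
      \<open>defect_inv\<close>.\<close>
    moreover have "c + (k + c + 2 * y + 1) - k = 2 * (c + y) + 1" by simp
    ultimately show ?thesis by (simp only: defect_inv_def) simp
  next
    case 2
    then have "\<not> k < x - y" by linarith
    with 2 show ?thesis by (simp add: defect_inv_def defect_def)
  next
    case 3
    \<comment> \<open>Since \<open>x - y \<le> k\<close>, the difference \<open>y - e\<close> is not
      truncated and \<open>g\<close> is the defect \<open>k + y - x\<close>.\<close>
    define e g where "e = x - k" and "g = y - e"
    have e: "x = k + e" "0 < e" "y = e + g" using 3 by (auto simp: e_def g_def)
    then have "defect k x y = g" "x + y = k + g + 2 * e" by (simp_all add: defect_def)
    moreover have "g + (k + g + 2 * e) - k = 2 * (e + g)" by simp
    ultimately show ?thesis using e by (simp only: defect_inv_def) simp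
  qed
qed

text \<open>Splitting by the sign and parity of \<open>m - k - s\<close>, with \<open>f\<close> its
  half rounded down, removes the divisions and turns later goals into linear arithmetic.\<close>

lemma defect_inv_cases:
  obtains "m \<le> k + s" "defect_inv k s m = s"
  | f where "f > 0" "m = k + s + 2 * f" "defect_inv k s m = s + f"
  | f where "m = k + s + 2 * f + 1" "defect_inv k s m = f"
proof (cases "m \<le> k + s")
  case True
  then show ?thesis using that(1) by (simp add: defect_inv_def)
next
  case False
  define e where "e = m - (k + s)"
  have e: "m = k + s + e" "e > 0" using False by (auto simp: e_def)
  show ?thesis
  proof (cases "even e")
    case True
    then obtain f where f: "e = 2 * f" by (elim evenE)
    show ?thesis by (rule that(2)[of f]) (use e f in \<open>simp_all add: defect_inv_def\<close>)
  next
    case False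
    then obtain f where f: "e = 2 * f + 1" by (elim oddE)
    show ?thesis by (rule that(3)[of f]) (use e f in \<open>simp_all add: defect_inv_def\<close>)
  qed
qed

text \<open>In the even case \<open>x - y = k - s\<close>, so \<open>s \<le> k\<close> is what gives
  \<open>y \<le> x\<close>, that is \<open>2 * y \<le> m\<close>.\<close>

lemma defect_defect_inv:
  assumes "2 * s \<le> m" "s \<le> k"
  shows "defect k (m - defect_inv k s m) (defect_inv k s m) = s" "2 * defect_inv k s m \<le> m"
proof -
  have "defect k (m - defect_inv k s m) (defect_inv k s m) = s \<and> 2 * defect_inv k s m \<le> m"
  proof (cases rule: defect_inv_cases[of m k s])
    case 1
    have "m - s \<le> k" using 1 by linarith
    then show ?thesis using 1 assms by (simp add: defect_def)
  qed (use assms in \<open>simp_all add: defect_def\<close>)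
  then show "defect k (m - defect_inv k s m) (defect_inv k s m) = s" "2 * defect_inv k s m \<le> m"
    by simp_all
qed

text \<open>For \<open>y = defect_inv k s m\<close> and \<open>x = m - y\<close>, the conclusions
  are the line conditions \<open>2 * n \<le> 3 * j\<close> and \<open>n \<le> 3 * i\<close>. With
  \<open>m = s + d\<close>, the second hypothesis expresses \<open>a \<ge> s\<close>.\<close>

lemma defect_inv_bounds:
  assumes "2 * s \<le> m" "s + m + 1 \<le> n" "n = 3 * k + r" "r = 1 \<or> r = 2"
  shows "defect_inv k s m \<le> k" "m - defect_inv k s m + k + 1 \<le> n"
proof -
  have "defect_inv k s m \<le> k \<and> m - defect_inv k s m + k + 1 \<le> n"
    by (cases rule: defect_inv_cases[of m k s]) (use assms in auto)
  then show "defect_inv k s m \<le> k" "m - defect_inv k s m + k + 1 \<le> n"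
    by simp_all
qed

section \<open>Transporting the sum along the bijection\<close>

lemma qt_catalan3_eq:
  assumes n: "n = 3 * k + r" "r = 1 \<or> r = 2"
  shows "qt_catalan3 n = (\<Sum>(s, a, d) \<in> {(s, a, d). a \<ge> s \<and> d \<ge> s \<and> a + s + d + 1 = n}. qvar ^ d * tvar ^ a)"
proof -
  let ?I = "{(i, j). i \<le> j \<and> j \<le> n \<and> n \<le> 3 * i \<and> 2 * n \<le> 3 * j}"
  have "qt_catalan3 n = (\<Sum>(i, j) \<in> ?I.
      qvar ^ dinv n (three_path n i j) * tvar ^ area n (three_path n i j))"
    unfolding qt_catalan3_def dyck_paths_eq
    by (subst sum.reindex[OF inj_on_three_path]) (simp add: case_prod_beta)
  also have "\<dots> = (\<Sum>(s, a, d) \<in> {(s, a, d). a \<ge> s \<and> d \<ge> s \<and> a + s + d + 1 = n}. qvar ^ d * tvar ^ a)"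
  proof -
    \<comment> \<open>\<open>F\<close> records defect, area and dinv. \<open>G\<close> finds
      \<open>y\<close> from \<open>s\<close> and \<open>m = s + d\<close>, then
      \<open>x = m - y\<close>, and returns to heights.\<close>
    define F where "F = (\<lambda>(i, j). (defect k (n - i) (n - j), i + j - (n + 1),
        (n - i) + (n - j) - defect k (n - i) (n - j)))"
    define G where "G = (\<lambda>(s, a :: nat, d). (n - (s + d - defect_inv k s (s + d)), n - defect_inv k s (s + d)))"
    have G_F: "G (F z) = z" "F z \<in> {(s, a, d). a \<ge> s \<and> d \<ge> s \<and> a + s + d + 1 = n}" if "z \<in> ?I" for z
    proof -
      obtain i j where z: "z = (i, j)" by fastforce
      define x where "x = n - i"
      define y where "y = n - j"
      have b: "y \<le> x" "y \<le> k" "x + k + 1 \<le> n" "i = n - x" "j = n - y"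
        using that n by (auto simp: z x_def y_def)
      \<comment> \<open>With \<open>d = x + y - s\<close> and \<open>a = n - 1 - x - y\<close>,
        these are \<open>d \<ge> s\<close> and \<open>a \<ge> s\<close>.\<close>
      have d: "2 * defect k x y \<le> x + y" "defect k x y + x + y + 1 \<le> n"
        using b n unfolding defect_def by auto
      have F: "F z = (defect k x y, n - 1 - x - y, x + y - defect k x y)"
        using b n by (simp add: F_def z flip: x_def y_def)
      show "G (F z) = z"
      proof -
        have "defect k x y + (x + y - defect k x y) = x + y" using d by simp
        then show ?thesis
          unfolding F G_def prod.case using defect_inv_defect[OF b(1), of k] b by (simp add: z)
      qed
      show "F z \<in> {(s, a, d). a \<ge> s \<and> d \<ge> s \<and> a + s + d + 1 = n}"
        using d by (auto simp: F)
    qed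
    have F_G: "F (G w) = w" "G w \<in> ?I"
      if "w \<in> {(s, a, d). a \<ge> s \<and> d \<ge> s \<and> a + s + d + 1 = n}" for w
    proof -
      obtain s a d where w: "w = (s, a, d)" by (cases w)
      define y where "y = defect_inv k s (s + d)"
      have sad: "a \<ge> s" "d \<ge> s" "a + s + d + 1 = n" using that by (auto simp: w)
      have b: "y \<le> k" "s + d - y + k + 1 \<le> n" "defect k (s + d - y) y = s" "2 * y \<le> s + d"
        using defect_inv_bounds[of s "s + d" n k r] defect_defect_inv[of s "s + d" k] sad n
        by (auto simp: y_def)
      show "G w \<in> ?I" using b n by (auto simp: G_def w simp flip: y_def)
      have "n - (n - (s + d - y)) = s + d - y" "n - (n - y) = y" using b by auto
      then show "F (G w) = w" using b sad by (auto simp: G_def F_def w simp flip: y_def)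
    qed
    have stats: "dinv n (three_path n i j) = (n - i) + (n - j) - defect k (n - i) (n - j)"
        "area n (three_path n i j) = i + j - (n + 1)" if "(i, j) \<in> ?I" for i j
    proof -
      have ij: "i \<le> j" "j \<le> n" "n \<le> 3 * i" "2 * n \<le> 3 * j" using that by auto
      show "area n (three_path n i j) = i + j - (n + 1)"
        by (rule area_three_path[OF ij(1,2) n ij(3,4)])
      show "dinv n (three_path n i j) = (n - i) + (n - j) - defect k (n - i) (n - j)"
        unfolding dinv_three_path[OF ij(1,2) n ij(3,4)] defect_def using ij n
        by (auto simp: min_def max_def)
    qed
    show ?thesis
      by (rule sum.reindex_bij_witness[of _ G F])
        (use G_F F_G stats in \<open>auto simp: F_def\<close>)
  qed
  finally show ?thesis .
qed

theorem mainTheorem1: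
  fixes n :: nat
  assumes "n \<ge> 1" and "\<not> 3 dvd n"
  shows "qt_catalan3 n =
           (\<Sum>s = 0..n div 3. \<Sum>(a, d) \<in> {(a, d). a \<ge> s \<and> d \<ge> s \<and> a + s + d + 1 = n}. qvar ^ d * tvar ^ a)
       \<and> (\<Sum>s = 0..n div 3. \<Sum>(a, d) \<in> {(a, d). a \<ge> s \<and> d \<ge> s \<and> a + s + d + 1 = n}. qvar ^ d * tvar ^ a) =
           (\<Sum>s = 0..n div 3. \<Sum>a = s..n - 2 * s - 1. qvar ^ (n - a - s - 1) * tvar ^ a)"
proof
  let ?A = "\<lambda>s. {(a, d). a \<ge> s \<and> d \<ge> s \<and> a + s + d + 1 = n}"
  have fin: "finite (?A s)" for s
    by (rule finite_subset[of _ "{..n} \<times> {..n}"]) auto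
  have "n mod 3 = 1 \<or> n mod 3 = 2" using assms(2) by presburger
  then have "qt_catalan3 n =
      (\<Sum>(s, a, d) \<in> {(s, a, d). a \<ge> s \<and> d \<ge> s \<and> a + s + d + 1 = n}. qvar ^ d * tvar ^ a)"
    by (intro qt_catalan3_eq[of n "n div 3" "n mod 3"]) auto
  \<comment> \<open>The constraints give \<open>3 * s + 1 \<le> n\<close>, hence the bound on
    \<open>s\<close>.\<close>
  also have "{(s, a, d). a \<ge> s \<and> d \<ge> s \<and> a + s + d + 1 = n} = Sigma {0..n div 3} ?A"
    by auto
  also have "(\<Sum>(s, a, d) \<in> Sigma {0..n div 3} ?A. qvar ^ d * tvar ^ a) =
      (\<Sum>s = 0..n div 3. \<Sum>(a, d) \<in> ?A s. qvar ^ d * tvar ^ a)"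
    using fin by (subst sum.Sigma) auto
  finally show "qt_catalan3 n = (\<Sum>s = 0..n div 3. \<Sum>(a, d) \<in> ?A s. qvar ^ d * tvar ^ a)" .
  show "(\<Sum>s = 0..n div 3. \<Sum>(a, d) \<in> ?A s. qvar ^ d * tvar ^ a) =
      (\<Sum>s = 0..n div 3. \<Sum>a = s..n - 2 * s - 1. qvar ^ (n - a - s - 1) * tvar ^ a)"
  proof (rule sum.cong[OF refl])
    fix s assume "s \<in> {0..n div 3}"
    \<comment> \<open>Non-divisibility excludes \<open>n = 3 * s\<close>. Hence
      \<open>n - 2 * s - 1\<close> is not truncated, and \<open>d = n - a - s - 1\<close> satisfies
      \<open>d \<ge> s\<close> exactly up to that value of \<open>a\<close>.\<close>
    then have "3 * s + 1 \<le> n" using assms by auto presburger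
    then show "(\<Sum>(a, d) \<in> ?A s. qvar ^ d * tvar ^ a) =
        (\<Sum>a = s..n - 2 * s - 1. qvar ^ (n - a - s - 1) * tvar ^ a)"
      by (intro sum.reindex_bij_witness[of _ "\<lambda>a. (a, n - a - s - 1)" fst]) auto
  qed
qed

end
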